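(* Let $q$ be a complex number with $0<|q|<1$. Then $$\sum_{k=1}^{\infty}[6k-1]\frac{(q^{-1},q,q;q^2)_k\,(q^{-2};q^4)_k}{(q^4,q^2,q^2;q^4)_k\,(q^{3};q^2)_k}\,q^{(k+1)^2}\sum_{i=1}^{k}\left(\frac{q^{2i-1}}{[2i-1]^2}-\frac{q^{4i-2}}{[4i-2]^2}\right) =\frac{(q,q^4,q^4;q^4)_{\infty}}{(q^5,q^2,q^2;q^4)_{\infty}}\sum_{i=1}^{\infty}\left(\frac{q^{4i-2}}{[4i-2]^2}-\frac{q^{4i}}{[4i]^2}\right).$$
   Context: The $q$-integer is $[n]=(1-q^n)/(1-q)$. The $q$-shifted factorials are $(x;q)_\infty=\prod_{i=0}^{\infty}(1-xq^i)$ and $(x;q)_n=(x;q)_\infty/(xq^n;q)_\infty$ (so $(x;q)_n=\prod_{i=0}^{n-1}(1-xq^i)$ for nonnegative integers $n$), and $(x_1,\dots,x_r;q)_m=(x_1;q)_m\cdots(x_r;q)_m$ for $m$ a nonnegative integer or $\infty$. *)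

theory Defs
  imports "HOL-Analysis.Analysis"
begin

definition q_int :: "complex \<Rightarrow> nat \<Rightarrow> complex" where
  "q_int q n = (1 - q ^ n) / (1 - q)"

definition q_poch_inf :: "complex \<Rightarrow> complex \<Rightarrow> complex" where
  "q_poch_inf x q = (\<Prod>i. 1 - x * q ^ i)"

text \<open>For a nonnegative integer \<open>n\<close> the finite product is used instead of the quotient
  \<open>(x;q)\<^sub>\<infinity> / (xq^n;q)\<^sub>\<infinity>\<close>, which reads \<open>0/0\<close> when the denominator vanishes. The two
  agree otherwise, see \<open>q_poch_eq_divide\<close> below.\<close>

definition q_poch :: "complex \<Rightarrow> complex \<Rightarrow> nat \<Rightarrow> complex" where
  "q_poch x q n = (\<Prod>i<n. 1 - x * q ^ i)"

text \<open>The multi-parameter symbols \<open>(x\<^sub>1,\<dots>,x\<^sub>r;q)\<^sub>n\<close> and \<open>(x\<^sub>1,\<dots>,x\<^sub>r;q)\<^sub>\<infinity>\<close>:\<close>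

definition q_pochs :: "complex list \<Rightarrow> complex \<Rightarrow> nat \<Rightarrow> complex" where
  "q_pochs xs q n = (\<Prod>x\<leftarrow>xs. q_poch x q n)"

definition q_pochs_inf :: "complex list \<Rightarrow> complex \<Rightarrow> complex" where
  "q_pochs_inf xs q = (\<Prod>x\<leftarrow>xs. q_poch_inf x q)"

lemma convergent_prod_q_poch:
  fixes x q :: complex
  assumes "norm q < 1"
  shows "convergent_prod (\<lambda>i. 1 - x * q ^ i)"
proof -
  have "summable (\<lambda>i. norm x * norm q ^ i)"
    using assms by (intro summable_mult summable_geometric) auto
  hence "summable (\<lambda>i. norm ((1 - x * q ^ i) - 1))"
    by (simp add: norm_mult norm_power)
  thus ?thesis
    by (intro abs_convergent_prod_imp_convergent_prod summable_imp_abs_convergent_prod)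
qed

lemma q_poch_eq_divide:
  assumes "norm q < 1" "q_poch_inf (x * q ^ n) q \<noteq> 0"
  shows "q_poch x q n = q_poch_inf x q / q_poch_inf (x * q ^ n) q"
proof -
  have "(\<lambda>i. \<Prod>j\<le>i. 1 - x * q ^ j) \<longlonglongrightarrow> q_poch_inf x q"
    unfolding q_poch_inf_def
    by (rule convergent_prod_LIMSEQ[OF convergent_prod_q_poch[OF assms(1)]])
  hence "(\<lambda>i. \<Prod>j\<le>i + n. 1 - x * q ^ j) \<longlonglongrightarrow> q_poch_inf x q"
    by (rule LIMSEQ_ignore_initial_segment)
  moreover have "(\<Prod>j\<le>i + n. 1 - x * q ^ j) = q_poch x q n * (\<Prod>j\<le>i. 1 - x * q ^ n * q ^ j)" for i
  proof -
    have "(\<Prod>j<m + n. 1 - x * q ^ j) = q_poch x q n * (\<Prod>j<m. 1 - x * q ^ n * q ^ j)" for m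
      by (induction m) (simp_all add: q_poch_def power_add mult_ac)
    from this[of "Suc i"] show ?thesis
      by (simp only: add_Suc lessThan_Suc_atMost)
  qed
  moreover have "(\<lambda>i. \<Prod>j\<le>i. 1 - x * q ^ n * q ^ j) \<longlonglongrightarrow> q_poch_inf (x * q ^ n) q"
    unfolding q_poch_inf_def
    by (rule convergent_prod_LIMSEQ[OF convergent_prod_q_poch[OF assms(1)]])
  hence "(\<lambda>i. q_poch x q n * (\<Prod>j\<le>i. 1 - x * q ^ n * q ^ j))
          \<longlonglongrightarrow> q_poch x q n * q_poch_inf (x * q ^ n) q"
    by (intro tendsto_intros)
  ultimately have "q_poch_inf x q = q_poch x q n * q_poch_inf (x * q ^ n) q"
    using LIMSEQ_unique by fastforce
  thus ?thesis using assms(2) by simp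
qed

end

theory Submission
  imports Defs "HOL-Complex_Analysis.Complex_Analysis"
begin

text \<open>
  The identity is the derivative at \<open>t = 0\<close> of a one-parameter family of summations. The
  quadratic summation
  \<open>\<Sum>\<^sub>k (1 - aq\<^sup>3\<^sup>k) (a,b,q/b;q)\<^sub>k (d;q\<^sup>2)\<^sub>k / ((aq/d;q)\<^sub>k (q\<^sup>2,aq\<^sup>2/b,abq;q\<^sup>2)\<^sub>k) (a/d)\<^sup>k q\<^bsup>k(k+1)/2\<^esup>
    = (a;q)\<^sub>\<infinity> (abq/d,aq\<^sup>2/(bd);q\<^sup>2)\<^sub>\<infinity> / ((aq/d;q)\<^sub>\<infinity> (abq,aq\<^sup>2/b;q\<^sup>2)\<^sub>\<infinity>)\<close>
  with base \<open>q\<close> replaced by \<open>q\<^sup>2\<close>, at \<open>a = q\<^sup>-\<^sup>1\<close>, \<open>d = q\<^sup>-\<^sup>2\<close>, \<open>b = qx\<close> has its \<open>k\<close>-th term proportional to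
  \<open>\<Prod>\<^sub>i (1 - t w(2i-1)) / (1 - t w(4i-2))\<close> and its right-hand side proportional to
  \<open>\<Prod>\<^sub>i (1 - t w(4i)) / (1 - t w(4i-2))\<close>, where \<open>t = x + 1/x - 2\<close> and \<open>w(m) = q\<^sup>m / (1 - q\<^sup>m)\<^sup>2\<close>.
  Logarithmic differentiation produces the two inner sums.

  The quadratic summation itself follows from a Wilf--Zeilberger pair for the shift \<open>a \<mapsto> aq\<^sup>2\<close>: each
  shift multiplies the sum by an explicit rational factor, and as \<open>aq\<^sup>2\<^sup>n \<rightarrow> 0\<close> only the term \<open>k = 0\<close>
  survives.
\<close>

section \<open>The quadratic summation\<close>

text \<open>The quadratic summation is usually stated with parameters \<open>a, b, d\<close>. Here \<open>e = 1/d\<close>, which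
  keeps the terms polynomial in \<open>e\<close>, and \<open>b\<close> enters only through \<open>s = b + q/b\<close>: for instance
  \<open>(1 - bx) (1 - qx/b) = 1 - sx + qx\<^sup>2\<close> and \<open>(1 - aq\<^sup>2y/b) (1 - abqy) = quad_factor a s q x\<close> for \<open>y = x\<^sup>2\<close>.\<close>

definition lin_factor :: "complex \<Rightarrow> complex \<Rightarrow> complex \<Rightarrow> complex \<Rightarrow> complex" where
  "lin_factor a e q x = 1 - a * e * q * x"

definition quad_factor :: "complex \<Rightarrow> complex \<Rightarrow> complex \<Rightarrow> complex \<Rightarrow> complex" where
  "quad_factor a s q x = 1 - a * q * s * x\<^sup>2 + a\<^sup>2 * q ^ 3 * x ^ 4"

text \<open>Quotient of consecutive summands at x = q^k, apart from the factor 1 - a q^(3k), which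
  \<open>quad_term\<close> restores. The product \<open>a * (e - x\<^sup>2)\<close> is (a/d) (1 - d
  x^2).\<close>

definition quad_ratio :: "complex \<Rightarrow> complex \<Rightarrow> complex \<Rightarrow> complex \<Rightarrow> complex \<Rightarrow> complex" where
  "quad_ratio a s e q x = a * q * x * (1 - a * x) * (1 - s * x + q * x\<^sup>2) * (e - x\<^sup>2)
     / (lin_factor a e q x * (1 - q\<^sup>2 * x\<^sup>2) * quad_factor a s q x)"

definition quad_term :: "complex \<Rightarrow> complex \<Rightarrow> complex \<Rightarrow> complex \<Rightarrow> nat \<Rightarrow> complex" where
  "quad_term a s e q k = (1 - a * q ^ (3 * k)) * (\<Prod>i<k. quad_ratio a s e q (q ^ i))"

text \<open>The closed form at \<open>a\<close> divided by the closed form at a q^2: all but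
  finitely many factors of the infinite products cancel.\<close>

definition quad_shift :: "complex \<Rightarrow> complex \<Rightarrow> complex \<Rightarrow> complex \<Rightarrow> complex" where
  "quad_shift a s e q = (1 - a) * (1 - a * q) * quad_factor (a * e) s q 1
     / (lin_factor a e q 1 * lin_factor a e q q * quad_factor a s q 1)"

section \<open>The Wilf--Zeilberger equation\<close>

text \<open>\<open>lin_factor\<close> depends on \<open>a\<close> and \<open>x\<close> only through
  a x, \<open>quad_factor\<close> only through a x^2. A shift of \<open>a\<close> by q^(2n)
  therefore moves along the powers of q, and nonvanishing or lower bounds along these powers pass to
  all shifted parameters.\<close>

lemma lin_factor_shift: "lin_factor (a * q ^ n) e q x = lin_factor a e q (q ^ n * x)"
  by (simp add: lin_factor_def mult_ac)

lemma quad_factor_shift: "quad_factor (a * q ^ (2 * n)) s q x = quad_factor a s q (q ^ n * x)"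
proof -
  have "q ^ (2 * n) = (q ^ n)\<^sup>2" by (simp add: power_mult[symmetric] mult.commute)
  then show ?thesis by (simp add: quad_factor_def power_mult_distrib mult_ac)
qed

lemma one_minus_power_nonzero:
  fixes q :: complex
  assumes "norm q < 1" "n > 0"
  shows "1 - q ^ n \<noteq> 0"
proof
  assume "1 - q ^ n = 0"
  then have "norm (q ^ n) = 1" by simp
  moreover have "norm q ^ n < 1" using assms by (simp add: power_less_one_iff)
  ultimately show False by (simp add: norm_power)
qed

lemma one_minus_norm_le_norm_one_minus_power:
  fixes q :: complex
  assumes "norm q < 1" "n > 0"
  shows "1 - norm q \<le> norm (1 - q ^ n)"
proof -
  have "norm (q ^ n) \<le> norm q"
    using assms power_decreasing[of 1 n "norm q"] by (simp add: norm_power)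
  then show ?thesis using norm_triangle_ineq2[of 1 "q ^ n"] by simp
qed

lemma square_mult_power_square: "q\<^sup>2 * (q ^ i)\<^sup>2 = (q::complex) ^ (2 * Suc i)"
  by (metis power_Suc power_mult power_mult_distrib mult.commute)

text \<open>The products for \<open>a\<close> and a q^2 overlap except at their ends, so their
  quotient is a rational function c of x = q^k. Induction works because c(x) turns into c(q x) when
  one more ratio is multiplied on; c(1) is \<open>quad_shift\<close>.\<close>

lemma quad_ratio_prod_shift:
  "quad_shift a s e q * (\<Prod>i<k. quad_ratio (a * q\<^sup>2) s e q (q ^ i))
   = (\<Prod>i<k. quad_ratio a s e q (q ^ i))
     * ((q ^ k)\<^sup>2 * (1 - a * q ^ k) * (1 - a * q * q ^ k) * quad_factor (a * e) s q 1
        / (lin_factor a e q (q ^ k) * lin_factor a e q (q * q ^ k) * quad_factor a s q (q ^ k)))"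
proof (induction k)
  case 0
  then show ?case by (simp add: quad_shift_def)
next
  case (Suc k)
  define x where "x = q ^ k"
  define c where "c = (\<lambda>x. x\<^sup>2 * (1 - a * x) * (1 - a * q * x) * quad_factor (a * e) s q 1
        / (lin_factor a e q x * lin_factor a e q (q * x) * quad_factor a s q x))"
  have r: "c x * quad_ratio (a * q\<^sup>2) s e q x = quad_ratio a s e q x * c (q * x)"
  proof -
    have l: "lin_factor (a * q\<^sup>2) e q x = lin_factor a e q (q * (q * x))"
      by (simp add: lin_factor_def power2_eq_square)
    have d: "quad_factor (a * q\<^sup>2) s q x = quad_factor a s q (q * x)"
      using quad_factor_shift[of a q 1 s x] by simp
    show ?thesis
      unfolding quad_ratio_def c_def l d times_divide_times_eq
      \<comment> \<open>Numerators and denominators agree separately, without any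
        cancellation.\<close>
      by (rule arg_cong2[where f = "(/)"]) (simp_all add: power2_eq_square mult_ac)
  qed
  have IH: "quad_shift a s e q * (\<Prod>i<k. quad_ratio (a * q\<^sup>2) s e q (q ^ i))
      = (\<Prod>i<k. quad_ratio a s e q (q ^ i)) * c x"
    using Suc by (simp add: c_def x_def)
  have "quad_shift a s e q * (\<Prod>i<Suc k. quad_ratio (a * q\<^sup>2) s e q (q ^ i))
      = (\<Prod>i<k. quad_ratio a s e q (q ^ i)) * c x * quad_ratio (a * q\<^sup>2) s e q x"
    by (simp flip: IH x_def)
  also have "\<dots> = (\<Prod>i<Suc k. quad_ratio a s e q (q ^ i)) * c (q * x)"
    using r by (simp flip: x_def)
  finally show ?case by (simp add: c_def x_def)
qed

text \<open>The Wilf--Zeilberger certificate for the shift \<open>a \<mapsto> aq\<^sup>2\<close>; the factor \<open>1 - a\<^sup>2eqx\<^sup>2\<close> comes from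
  solving the telescoping equation for a polynomial of degree two in \<open>x = q\<^sup>k\<close>.\<close>

definition quad_cert :: "complex \<Rightarrow> complex \<Rightarrow> complex \<Rightarrow> complex \<Rightarrow> nat \<Rightarrow> complex" where
  "quad_cert a s e q k = (\<Prod>i<k. quad_ratio a s e q (q ^ i))
     * ((1 - (q ^ k)\<^sup>2) * (1 - a\<^sup>2 * e * q * (q ^ k)\<^sup>2) / lin_factor a e q (q ^ k))"

lemma quad_term_telescope:
  assumes q: "norm q < 1"
    and lin: "\<And>i. lin_factor a e q (q ^ i) \<noteq> 0"
    and quad: "\<And>i. quad_factor a s q (q ^ i) \<noteq> 0"
  shows "quad_shift a s e q * quad_term (a * q\<^sup>2) s e q k - quad_term a s e q k
         = quad_cert a s e q (Suc k) - quad_cert a s e q k"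
proof -
  define x where "x = q ^ k"
  define P where "P = (\<Prod>i<k. quad_ratio a s e q (q ^ i))"
  define D D' E N B where "D = lin_factor a e q x" and "D' = lin_factor a e q (q * x)"
    and "E = quad_factor a s q x" and "N = 1 - q\<^sup>2 * x\<^sup>2" and "B = quad_factor (a * e) s q 1"
  have nz: "D \<noteq> 0" "D' \<noteq> 0" "E \<noteq> 0" "N \<noteq> 0"
    using lin[of k] lin[of "Suc k"] quad[of k] one_minus_power_nonzero[OF q, of "2 * Suc k"]
    unfolding D_def D'_def E_def N_def x_def square_mult_power_square by simp_all
  have sh: "quad_shift a s e q * (\<Prod>i<k. quad_ratio (a * q\<^sup>2) s e q (q ^ i))
      = P * (x\<^sup>2 * (1 - a * x) * (1 - a * q * x) * B / (D * D' * E))"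
    by (simp add: quad_ratio_prod_shift x_def P_def B_def D_def D'_def E_def)
  have pw: "q ^ (3 * k) = x ^ 3" by (simp add: x_def power_mult[symmetric] mult.commute)
  \<comment> \<open>This is the whole Wilf--Zeilberger equation after division by P and
    multiplication by \<open>D * D' * E\<close>; what follows only restores the
    denominators.\<close>
  have poly: "x\<^sup>2 * (1 - a * x) * (1 - a * q * x) * B * (1 - a * q\<^sup>2 * x ^ 3)
        - (1 - a * x ^ 3) * (D * D' * E)
      = a * q * x * (1 - a * x) * (1 - s * x + q * x\<^sup>2) * (e - x\<^sup>2)
          * (1 - a\<^sup>2 * e * q * (q * x)\<^sup>2)
        - (1 - x\<^sup>2) * (1 - a\<^sup>2 * e * q * x\<^sup>2) * (D' * E)"
    unfolding B_def D_def D'_def E_def lin_factor_def quad_factor_def power_one mult_1_right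
    by algebra
  have "quad_shift a s e q * quad_term (a * q\<^sup>2) s e q k - quad_term a s e q k
      = P * ((x\<^sup>2 * (1 - a * x) * (1 - a * q * x) * B * (1 - a * q\<^sup>2 * x ^ 3)
        - (1 - a * x ^ 3) * (D * D' * E)) / (D * D' * E))"
  proof -
    have "quad_shift a s e q * quad_term (a * q\<^sup>2) s e q k
      = (1 - a * q\<^sup>2 * x ^ 3) * (quad_shift a s e q * (\<Prod>i<k. quad_ratio (a * q\<^sup>2) s e q (q ^ i)))"
      by (simp add: quad_term_def pw)
    moreover have "quad_term a s e q k = (1 - a * x ^ 3) * P"
      by (simp add: quad_term_def pw P_def)
    moreover have "c * (P * (n / d)) - m * P = P * ((n * c - m * d) / d)"
      if "d \<noteq> 0" for c d m n :: complex
      using that by (simp add: field_simps)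
    ultimately show ?thesis
      unfolding sh using nz by simp
  qed
  also have "\<dots> = P * (a * q * x * (1 - a * x) * (1 - s * x + q * x\<^sup>2) * (e - x\<^sup>2)
          * (1 - a\<^sup>2 * e * q * (q * x)\<^sup>2) / (D * D' * E)
        - (1 - x\<^sup>2) * (1 - a\<^sup>2 * e * q * x\<^sup>2) / D)"
    unfolding poly using nz by (simp add: diff_divide_distrib)
  also have "\<dots> = quad_cert a s e q (Suc k) - quad_cert a s e q k"
  proof -
    have "quad_cert a s e q k = P * ((1 - x\<^sup>2) * (1 - a\<^sup>2 * e * q * x\<^sup>2) / D)"
      by (simp add: quad_cert_def P_def x_def D_def)
    \<comment> \<open>The factor 1 - x^2 of the certificate becomes N at \<open>Suc k\<close> and
      cancels the N in the denominator of \<open>quad_ratio\<close>.\<close>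
    moreover have "quad_cert a s e q (Suc k) = P * quad_ratio a s e q x
        * (N * (1 - a\<^sup>2 * e * q * (q * x)\<^sup>2) / D')"
      by (simp add: quad_cert_def P_def x_def D'_def N_def power_mult_distrib)
    moreover have "quad_ratio a s e q x = a * q * x * (1 - a * x) * (1 - s * x + q * x\<^sup>2) * (e - x\<^sup>2)
        / (D * N * E)"
      by (simp add: quad_ratio_def D_def N_def E_def)
    moreover have "P * (n * u / (D * D' * E) - m / D) = P * (n / (D * N * E)) * (N * u / D') - P * (m / D)"
      for m n u using nz by (simp add: field_simps)
    ultimately show ?thesis by simp
  qed
  finally show ?thesis .
qed

section \<open>Majorants uniform in the parameters\<close>

text \<open>The quotient of consecutive products tends to 0, so it is eventually below 1/2 however
  large \<open>M\<close> is.\<close>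

lemma summable_prod_geometric:
  fixes M r :: real
  assumes "0 \<le> M" "0 \<le> r" "r < 1"
  shows "summable (\<lambda>k. \<Prod>i<k. M * r ^ Suc i)"
proof -
  have "(\<lambda>n. M * r ^ Suc n) \<longlonglongrightarrow> M * 0"
    using assms by (intro tendsto_mult tendsto_const LIMSEQ_Suc LIMSEQ_power_zero) auto
  then have "\<forall>\<^sub>F n in sequentially. M * r ^ Suc n < 1 / 2"
    by (intro order_tendstoD) auto
  then obtain N where N: "\<And>n. n \<ge> N \<Longrightarrow> M * r ^ Suc n < 1 / 2"
    by (auto simp: eventually_sequentially)
  show ?thesis
  proof (rule summable_ratio_test[where c = "1 / 2" and N = N])
    fix n assume "n \<ge> N"
    have "norm (\<Prod>i<Suc n. M * r ^ Suc i) = (M * r ^ Suc n) * norm (\<Prod>i<n. M * r ^ Suc i)"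
      using assms by (simp add: abs_mult)
    also have "\<dots> \<le> 1 / 2 * norm (\<Prod>i<n. M * r ^ Suc i)"
      using N[OF \<open>n \<ge> N\<close>] by (intro mult_right_mono) auto
    finally show "norm (\<Prod>i<Suc n. M * r ^ Suc i) \<le> 1 / 2 * norm (\<Prod>i<n. M * r ^ Suc i)" .
  qed simp
qed

text \<open>A, B, E bound |a|, |s|, |e|, and \<delta> bounds the three denominators of
  \<open>quad_ratio\<close> from below. The factor q x is left out: it supplies the geometric
  decay.\<close>

definition quad_bound :: "real \<Rightarrow> real \<Rightarrow> real \<Rightarrow> real \<Rightarrow> real" where
  "quad_bound A B E \<delta> = A * (1 + A) * (2 + B) * (E + 1) / \<delta> ^ 3"

lemma norm_quad_ratio_le:
  assumes q: "norm q < 1" and a: "norm a \<le> A" and s: "norm s \<le> B" and e: "norm e \<le> E"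
    and \<delta>: "0 < \<delta>" "\<delta> \<le> 1 - norm q"
    and lin: "\<delta> \<le> norm (lin_factor a e q (q ^ i))"
    and quad: "\<delta> \<le> norm (quad_factor a s q (q ^ i))"
  shows "norm (quad_ratio a s e q (q ^ i)) \<le> quad_bound A B E \<delta> * norm q ^ Suc i"
proof -
  define x where "x = q ^ i"
  have x: "norm x \<le> 1"
    using q by (simp add: x_def norm_power power_le_one)
  have pos: "0 \<le> A" "0 \<le> B" "0 \<le> E"
    using norm_ge_zero[of a] norm_ge_zero[of s] norm_ge_zero[of e] a s e by linarith+
  have x2: "norm (x\<^sup>2) \<le> 1" using x by (simp add: norm_power power_le_one)
  have ax: "norm (1 - a * x) \<le> 1 + A"
  proof -
    have "norm (a * x) \<le> A * 1" unfolding norm_mult using a x pos by (intro mult_mono) auto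
    then show ?thesis using norm_triangle_ineq4[of 1 "a * x"] by simp
  qed
  have sx: "norm (1 - s * x + q * x\<^sup>2) \<le> 2 + B"
  proof -
    have "norm (s * x) \<le> B * 1" unfolding norm_mult using s x pos by (intro mult_mono) auto
    moreover have "norm (q * x\<^sup>2) \<le> 1 * 1" unfolding norm_mult using q x2 by (intro mult_mono) auto
    moreover have "norm (1 - s * x + q * x\<^sup>2) \<le> 1 + norm (s * x) + norm (q * x\<^sup>2)"
      using norm_triangle_ineq[of "1 - s * x" "q * x\<^sup>2"] norm_triangle_ineq4[of 1 "s * x"] by simp
    ultimately show ?thesis by simp
  qed
  have ex: "norm (e - x\<^sup>2) \<le> E + 1"
    using norm_triangle_ineq4[of e "x\<^sup>2"] e x2 by linarith
  have qx: "\<delta> \<le> norm (1 - q\<^sup>2 * x\<^sup>2)"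
    using one_minus_norm_le_norm_one_minus_power[OF q, of "2 * Suc i"] \<delta>
    unfolding x_def square_mult_power_square by simp
  have "norm (quad_ratio a s e q x)
      = norm a * norm (1 - a * x) * norm (1 - s * x + q * x\<^sup>2) * norm (e - x\<^sup>2) * norm (q * x)
        / (norm (lin_factor a e q x) * norm (1 - q\<^sup>2 * x\<^sup>2) * norm (quad_factor a s q x))"
    unfolding quad_ratio_def norm_divide norm_mult by (simp add: mult_ac)
  also have "\<dots> \<le> A * (1 + A) * (2 + B) * (E + 1) * norm (q * x) / (\<delta> * \<delta> * \<delta>)"
    using pos a ax sx ex qx lin quad \<delta>(1)
    by (intro frac_le mult_mono mult_nonneg_nonneg mult_pos_pos) (auto simp: x_def)
  also have "\<dots> = quad_bound A B E \<delta> * norm q ^ Suc i"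
    by (simp add: quad_bound_def x_def norm_mult norm_power power3_eq_cube)
  finally show ?thesis by (simp add: x_def)
qed

lemma norm_quad_prod_le:
  assumes q: "norm q < 1" and a: "norm a \<le> A" and s: "norm s \<le> B" and e: "norm e \<le> E"
    and \<delta>: "0 < \<delta>" "\<delta> \<le> 1 - norm q"
    and lin: "\<And>i. \<delta> \<le> norm (lin_factor a e q (q ^ i))"
    and quad: "\<And>i. \<delta> \<le> norm (quad_factor a s q (q ^ i))"
  shows "norm (\<Prod>i<k. quad_ratio a s e q (q ^ i)) \<le> (\<Prod>i<k. quad_bound A B E \<delta> * norm q ^ Suc i)"
  unfolding prod_norm[symmetric]
  using norm_quad_ratio_le[OF q a s e \<delta> lin quad] by (intro prod_mono) auto

text \<open>The majorant sees \<open>a\<close>, \<open>s\<close>, \<open>e\<close> only through A,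
  B, E and \<delta>. It thus serves all shifts a q^(2n) at once, and later all t in a disc.\<close>

lemma norm_quad_term_le:
  assumes q: "norm q < 1" and a: "norm a \<le> A" and s: "norm s \<le> B" and e: "norm e \<le> E"
    and \<delta>: "0 < \<delta>" "\<delta> \<le> 1 - norm q"
    and lin: "\<And>i. \<delta> \<le> norm (lin_factor a e q (q ^ i))"
    and quad: "\<And>i. \<delta> \<le> norm (quad_factor a s q (q ^ i))"
  shows "norm (quad_term a s e q k) \<le> (1 + A) * (\<Prod>i<k. quad_bound A B E \<delta> * norm q ^ Suc i)"
proof -
  have "norm (a * q ^ (3 * k)) \<le> A * 1"
    unfolding norm_mult using a q order_trans[OF norm_ge_zero a]
    by (intro mult_mono) (auto simp: norm_power power_le_one)
  then have "norm (1 - a * q ^ (3 * k)) \<le> 1 + A"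
    using norm_triangle_ineq4[of 1 "a * q ^ (3 * k)"] by simp
  then show ?thesis
    unfolding quad_term_def norm_mult using norm_quad_prod_le[OF assms]
    by (intro mult_mono) (use order_trans[OF norm_ge_zero a] in auto)
qed

lemma quad_bound_nonneg:
  assumes "0 \<le> A" "0 \<le> B" "0 \<le> E" "0 < \<delta>"
  shows "0 \<le> quad_bound A B E \<delta>"
  using assms by (simp add: quad_bound_def)

text \<open>The inverses converge, hence are bounded.\<close>

lemma norm_bounded_below:
  fixes f :: "nat \<Rightarrow> complex"
  assumes "f \<longlonglongrightarrow> 1" "\<And>n. f n \<noteq> 0"
  obtains \<delta> where "\<delta> > 0" "\<And>n. \<delta> \<le> norm (f n)"
proof -
  have "(\<lambda>n. inverse (f n)) \<longlonglongrightarrow> inverse 1"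
    using assms(1) by (rule tendsto_inverse) simp
  then have "Bseq (\<lambda>n. inverse (f n))"
    using convergentI convergent_imp_Bseq by blast
  then obtain K where K: "K > 0" "\<And>n. norm (inverse (f n)) \<le> K"
    by (auto elim: BseqE)
  have "inverse K \<le> norm (f n)" for n
    using K(2)[of n] K(1) assms(2)[of n]
    by (simp add: norm_divide field_simps)
  then show ?thesis using that[of "inverse K"] K(1) by simp
qed

text \<open>Shifting \<open>a\<close> only passes to later members of the sequences of
  \<open>lin_factor\<close> and \<open>quad_factor\<close> values and does not increase |a|, so one
  \<delta> works for every n. The bound on the bare products makes the certificate tend to
  0.\<close>

lemma quad_term_dominated:
  assumes q: "norm q < 1"
    and lin: "\<And>i. lin_factor a e q (q ^ i) \<noteq> 0"
    and quad: "\<And>i. quad_factor a s q (q ^ i) \<noteq> 0"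
  obtains h where "summable h" "\<And>n k. norm (quad_term (a * q ^ (2 * n)) s e q k) \<le> h k"
    "\<And>k. norm (\<Prod>i<k. quad_ratio a s e q (q ^ i)) \<le> h k"
proof -
  have qi: "(\<lambda>i. q ^ i) \<longlonglongrightarrow> 0" using q by (rule LIMSEQ_power_zero)
  have "(\<lambda>i. lin_factor a e q (q ^ i)) \<longlonglongrightarrow> 1 - a * e * q * 0"
    unfolding lin_factor_def by (intro tendsto_intros qi)
  then obtain d1 where d1: "d1 > 0" "\<And>i. d1 \<le> norm (lin_factor a e q (q ^ i))"
    using norm_bounded_below[of "\<lambda>i. lin_factor a e q (q ^ i)"] lin by auto
  have "(\<lambda>i. quad_factor a s q (q ^ i)) \<longlonglongrightarrow> 1 - a * q * s * 0\<^sup>2 + a\<^sup>2 * q ^ 3 * 0 ^ 4"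
    unfolding quad_factor_def by (intro tendsto_intros qi)
  then obtain d2 where d2: "d2 > 0" "\<And>i. d2 \<le> norm (quad_factor a s q (q ^ i))"
    using norm_bounded_below[of "\<lambda>i. quad_factor a s q (q ^ i)"] quad by auto
  define d where "d = min (1 - norm q) (min d1 d2)"
  have d: "0 < d" "d \<le> 1 - norm q" using d1(1) d2(1) q by (auto simp: d_def)
  have dl: "d \<le> norm (lin_factor (a * q ^ (2 * n)) e q (q ^ i))" for n i
    unfolding lin_factor_shift power_add[symmetric] using d1(2)[of "2 * n + i"] by (simp add: d_def)
  have dq: "d \<le> norm (quad_factor (a * q ^ (2 * n)) s q (q ^ i))" for n i
    unfolding quad_factor_shift power_add[symmetric] using d2(2)[of "n + i"] by (simp add: d_def)
  have an: "norm (a * q ^ (2 * n)) \<le> norm a" for n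
    using q mult_left_mono[of "norm q ^ (2 * n)" 1 "norm a"] by (simp add: norm_mult norm_power power_le_one)
  define M where "M = quad_bound (norm a) (norm s) (norm e) d"
  have M: "M \<ge> 0" unfolding M_def by (rule quad_bound_nonneg) (use d in auto)
  show ?thesis
  proof
    show "summable (\<lambda>k. (1 + norm a) * (\<Prod>i<k. M * norm q ^ Suc i))"
      using M q by (intro summable_mult summable_prod_geometric) auto
    show "norm (quad_term (a * q ^ (2 * n)) s e q k) \<le> (1 + norm a) * (\<Prod>i<k. M * norm q ^ Suc i)" for n k
      unfolding M_def by (rule norm_quad_term_le[OF q an order_refl order_refl d dl dq])
    have "norm (\<Prod>i<k. quad_ratio a s e q (q ^ i)) \<le> 1 * (\<Prod>i<k. M * norm q ^ Suc i)" for k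
      using norm_quad_prod_le[OF q order_refl[of "norm a"] order_refl order_refl d dl[of 0, simplified] dq[of 0, simplified]]
      by (simp add: M_def)
    moreover have "1 * (\<Prod>i<k. M * norm q ^ Suc i) \<le> (1 + norm a) * (\<Prod>i<k. M * norm q ^ Suc i)" for k
      using M by (intro mult_right_mono prod_nonneg) auto
    ultimately show "norm (\<Prod>i<k. quad_ratio a s e q (q ^ i)) \<le> (1 + norm a) * (\<Prod>i<k. M * norm q ^ Suc i)" for k
      using order_trans by blast
  qed
qed

section \<open>Summation over k and iteration of the shift\<close>

lemma quad_sum_shift:
  assumes q: "norm q < 1"
    and lin: "\<And>i. lin_factor a e q (q ^ i) \<noteq> 0"
    and quad: "\<And>i. quad_factor a s q (q ^ i) \<noteq> 0"
  shows "(\<Sum>k. quad_term a s e q k) = quad_shift a s e q * (\<Sum>k. quad_term (a * q\<^sup>2) s e q k)"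
proof -
  obtain h where h: "summable h" "\<And>n k. norm (quad_term (a * q ^ (2 * n)) s e q k) \<le> h k"
    "\<And>k. norm (\<Prod>i<k. quad_ratio a s e q (q ^ i)) \<le> h k"
    using quad_term_dominated[OF assms] by metis
  have sm: "summable (quad_term (a * q ^ (2 * n)) s e q)" for n
    by (rule summable_comparison_test'[OF h(1)]) (use h(2) in auto)
  have qk: "(\<lambda>k. q ^ k) \<longlonglongrightarrow> 0" using q by (rule LIMSEQ_power_zero)
  have P: "(\<lambda>k. \<Prod>i<k. quad_ratio a s e q (q ^ i)) \<longlonglongrightarrow> 0"
    by (rule Lim_null_comparison[OF _ summable_LIMSEQ_zero[OF h(1)]]) (use h(3) in auto)
  have "quad_cert a s e q \<longlonglongrightarrow> 0 * ((1 - 0\<^sup>2) * (1 - a\<^sup>2 * e * q * 0\<^sup>2) / (1 - a * e * q * 0))"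
    unfolding quad_cert_def lin_factor_def by (intro tendsto_intros P qk) auto
  then have "quad_cert a s e q \<longlonglongrightarrow> 0" by simp
  then have "(\<lambda>k. quad_cert a s e q (Suc k) - quad_cert a s e q k) sums (0 - quad_cert a s e q 0)"
    by (rule telescope_sums)
  \<comment> \<open>The boundary term at k = 0 vanishes too, because of the factor 1 - (q^k)^2 in
    the certificate.\<close>
  then have "(\<lambda>k. quad_shift a s e q * quad_term (a * q\<^sup>2) s e q k - quad_term a s e q k) sums 0"
    unfolding quad_term_telescope[OF assms] by (simp add: quad_cert_def)
  moreover have "(\<lambda>k. quad_shift a s e q * quad_term (a * q\<^sup>2) s e q k - quad_term a s e q k)
      sums (quad_shift a s e q * (\<Sum>k. quad_term (a * q\<^sup>2) s e q k) - (\<Sum>k. quad_term a s e q k))"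
    using sm[of 1] sm[of 0] by (intro sums_diff sums_mult summable_sums) auto
  ultimately show ?thesis using sums_unique2 by fastforce
qed

text \<open>The right-hand side stays a limit of finite products of shift factors; it is evaluated
  only for the special parameters, where these products simplify.\<close>

theorem quad_summation:
  assumes q: "norm q < 1"
    and lin: "\<And>i. lin_factor a e q (q ^ i) \<noteq> 0"
    and quad: "\<And>i. quad_factor a s q (q ^ i) \<noteq> 0"
  shows "(\<lambda>n. \<Prod>j<n. quad_shift (a * q ^ (2 * j)) s e q) \<longlonglongrightarrow> (\<Sum>k. quad_term a s e q k)"
proof -
  obtain h where h: "summable h" "\<And>n k. norm (quad_term (a * q ^ (2 * n)) s e q k) \<le> h k"
    using quad_term_dominated[OF assms] by metis
  define S where "S n = (\<Sum>k. quad_term (a * q ^ (2 * n)) s e q k)" for n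
  have step: "S n = quad_shift (a * q ^ (2 * n)) s e q * S (Suc n)" for n
  proof -
    have "lin_factor (a * q ^ (2 * n)) e q (q ^ i) \<noteq> 0" for i
      unfolding lin_factor_shift power_add[symmetric] by (rule lin)
    moreover have "quad_factor (a * q ^ (2 * n)) s q (q ^ i) \<noteq> 0" for i
      unfolding quad_factor_shift power_add[symmetric] by (rule quad)
    ultimately show ?thesis
      using quad_sum_shift[OF q] by (simp add: S_def power2_eq_square mult_ac)
  qed
  have S0: "S 0 = (\<Prod>j<n. quad_shift (a * q ^ (2 * j)) s e q) * S n" for n
  proof (induction n)
    case (Suc n)
    then show ?case by (simp add: mult.assoc flip: step[of n])
  qed simp
  have an: "(\<lambda>n. a * q ^ (2 * n)) \<longlonglongrightarrow> 0"
  proof -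
    have "norm (q\<^sup>2) < 1" using q by (simp add: norm_power power_less_one_iff)
    then have "(\<lambda>n. a * (q\<^sup>2) ^ n) \<longlonglongrightarrow> a * 0" by (intro tendsto_intros LIMSEQ_power_zero)
    then show ?thesis by (simp add: power_mult)
  qed
  \<comment> \<open>Every \<open>quad_ratio\<close> contains the factor \<open>a\<close>, so a term
    with k > 0 dies as \<open>a\<close> tends to 0.\<close>
  have lim: "(\<lambda>n. quad_term (a * q ^ (2 * n)) s e q k) \<longlonglongrightarrow> (if k = 0 then 1 else 0)" for k
  proof -
    have r: "(\<lambda>n. quad_ratio (a * q ^ (2 * n)) s e q (q ^ i)) \<longlonglongrightarrow>
       0 * q * q ^ i * (1 - 0 * q ^ i) * (1 - s * q ^ i + q * (q ^ i)\<^sup>2) * (e - (q ^ i)\<^sup>2)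
        / ((1 - 0 * e * q * q ^ i) * (1 - q\<^sup>2 * (q ^ i)\<^sup>2) * (1 - 0 * q * s * (q ^ i)\<^sup>2 + 0\<^sup>2 * q ^ 3 * (q ^ i) ^ 4))" for i
      unfolding quad_ratio_def lin_factor_def quad_factor_def
      using one_minus_power_nonzero[OF q, of "2 * Suc i"]
      unfolding square_mult_power_square by (intro tendsto_intros an) simp
    have "(\<lambda>n. quad_term (a * q ^ (2 * n)) s e q k) \<longlonglongrightarrow> (1 - 0 * q ^ (3 * k)) * (\<Prod>i<k. 0)"
      unfolding quad_term_def by (intro tendsto_intros an) (use r in simp)
    then show ?thesis by (auto simp: power_0_left)
  qed
  have "\<forall>\<^sub>F (k, n) in at_top \<times>\<^sub>F sequentially. norm (quad_term (a * q ^ (2 * n)) s e q k) \<le> h k"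
    using h(2) by (intro always_eventually) auto
  from tannerys_theorem[OF lim this h(1)]
  have "S \<longlonglongrightarrow> (\<Sum>k. if k = 0 then 1 else 0)"
    by (simp add: S_def[abs_def])
  also have "(\<Sum>k::nat. if k = 0 then 1 else 0 :: complex) = 1"
    using sums_If_finite[of "\<lambda>k::nat. k = 0" "\<lambda>_. 1 :: complex"] by (simp add: sums_iff)
  finally have S1: "S \<longlonglongrightarrow> 1" .
  \<comment> \<open>S n is known to be nonzero only for large n, where it is close to 1; that
    suffices for the limit.\<close>
  then have "(\<lambda>n. S 0 / S n) \<longlonglongrightarrow> S 0 / 1" by (intro tendsto_intros) auto
  moreover have "\<forall>\<^sub>F n in sequentially. S 0 / S n = (\<Prod>j<n. quad_shift (a * q ^ (2 * j)) s e q)"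
    using tendsto_imp_eventually_ne[OF S1 one_neq_zero]
  proof eventually_elim
    case (elim n)
    then show ?case using S0[of n] by simp
  qed
  ultimately show ?thesis using tendsto_cong by (fastforce simp: S_def)
qed

section \<open>Specialization and differentiation\<close>

text \<open>All factors equal 1 at t = 0, so the product rule just adds their derivatives.\<close>

lemma has_field_derivative_prod_ratio_0:
  fixes a b :: "nat \<Rightarrow> complex"
  shows "((\<lambda>t. \<Prod>i<k. (1 - t * a i) / (1 - t * b i)) has_field_derivative (\<Sum>i<k. b i - a i)) (at 0)"
proof (induction k)
  case (Suc k)
  have "((\<lambda>t. (1 - t * a k) / (1 - t * b k)) has_field_derivative (b k - a k)) (at 0)"
    by (auto intro!: derivative_eq_intros)
  from DERIV_mult[OF Suc this] show ?case by (simp add: add.commute)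
qed simp

definition q_weight :: "complex \<Rightarrow> nat \<Rightarrow> complex" where
  "q_weight q m = q ^ m / (1 - q ^ m)\<^sup>2"

lemma norm_q_weight_le:
  assumes "norm q < 1" "m > 0"
  shows "norm (q_weight q m) \<le> norm q ^ m / (1 - norm q)\<^sup>2"
  unfolding q_weight_def norm_divide norm_power
  using one_minus_norm_le_norm_one_minus_power[OF assms] assms(1)
  by (intro frac_le power_mono) auto

lemma norm_q_weight_le':
  assumes "norm q < 1" "m > 0"
  shows "norm (q_weight q m) \<le> 1 / (1 - norm q)\<^sup>2"
  using norm_q_weight_le[OF assms] assms(1)
  by (smt (verit) divide_right_mono power_le_one norm_ge_zero zero_le_power2)

text \<open>With 2 + t = x + 1/x the left side is (1 - x q^m) (1 - q^m/x). Taking out its value at t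
  = 0 leaves a factor linear in t, whose slope is the weight up to sign.\<close>

lemma square_minus_eq:
  assumes "norm q < 1" "m > 0"
  shows "1 - (2 + t) * q ^ m + (q ^ m)\<^sup>2 = (1 - q ^ m)\<^sup>2 * (1 - t * q_weight q m)"
  using one_minus_power_nonzero[OF assms]
  by (simp add: q_weight_def right_diff_distrib) (simp add: power2_eq_square algebra_simps)

text \<open>The radius is half the reciprocal of the uniform bound on the weights, so on this disc
  no denominator comes near 0.\<close>

lemma norm_one_minus_q_weight_ge:
  assumes q: "norm q < 1" and m: "m > 0" and t: "norm t \<le> (1 - norm q)\<^sup>2 / 2"
  shows "1 / 2 \<le> norm (1 - t * q_weight q m)"
proof -
  have "norm (t * q_weight q m) \<le> (1 - norm q)\<^sup>2 / 2 * (1 / (1 - norm q)\<^sup>2)"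
    unfolding norm_mult using t norm_q_weight_le'[OF q m] by (intro mult_mono) auto
  also have "\<dots> = 1 / 2" using q by simp
  finally show ?thesis using norm_triangle_ineq2[of 1 "t * q_weight q m"] by simp
qed

text \<open>The parameter \<open>t\<close> stands for \<open>x + 1/x - 2\<close> where \<open>b = qx\<close> (in base \<open>q\<^sup>2\<close>). The terms are
  even in \<open>ln x\<close>, hence critical at \<open>x = 1\<close>; as functions of \<open>t\<close> a first derivative at \<open>t = 0\<close> suffices.\<close>

abbreviation special_term :: "complex \<Rightarrow> complex \<Rightarrow> nat \<Rightarrow> complex" where
  "special_term q t \<equiv> quad_term (inverse q) (q * (2 + t)) (q\<^sup>2) (q\<^sup>2)"

lemma q_poch_LIMSEQ:
  assumes "norm q < 1"
  shows "q_poch x q \<longlonglongrightarrow> q_poch_inf x q"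
proof (rule LIMSEQ_imp_Suc)
  show "(\<lambda>n. q_poch x q (Suc n)) \<longlonglongrightarrow> q_poch_inf x q"
    unfolding q_poch_def q_poch_inf_def lessThan_Suc_atMost
    by (rule convergent_prod_LIMSEQ[OF convergent_prod_q_poch[OF assms]])
qed

lemma q_poch_inf_nonzero:
  assumes "norm q < 1" "\<And>i. 1 - x * q ^ i \<noteq> 0"
  shows "q_poch_inf x q \<noteq> 0"
  unfolding q_poch_inf_def
  by (rule prodinf_nonzero[OF convergent_prod_q_poch[OF assms(1)] assms(2)])

lemma summable_norm_q_weight:
  assumes q: "norm q < 1" and "b > 0"
  shows "summable (\<lambda>i. norm (q_weight q (4 * i + b)))"
proof (rule summable_comparison_test')
  show "summable (\<lambda>i. norm q ^ i / (1 - norm q)\<^sup>2)"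
    using q by (intro summable_divide summable_geometric) auto
  fix i
  have "norm (q_weight q (4 * i + b)) \<le> norm q ^ (4 * i + b) / (1 - norm q)\<^sup>2"
    using norm_q_weight_le[OF q] \<open>b > 0\<close> by simp
  also have "\<dots> \<le> norm q ^ i / (1 - norm q)\<^sup>2"
    using q by (intro divide_right_mono power_decreasing) auto
  finally show "norm (norm (q_weight q (4 * i + b))) \<le> norm q ^ i / (1 - norm q)\<^sup>2" by simp
qed

lemma prod_odd_powers: "q * (\<Prod>i<k. q ^ (2 * i + 3)) = (q :: complex) ^ ((k + 1)\<^sup>2)"
proof (induction k)
  case (Suc k)
  have "(Suc k + 1)\<^sup>2 = (k + 1)\<^sup>2 + (2 * k + 3)" by (simp add: power2_eq_square)
  then have "q ^ ((Suc k + 1)\<^sup>2) = q ^ ((k + 1)\<^sup>2) * q ^ (2 * k + 3)" by (simp only: power_add)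
  also have "q ^ ((k + 1)\<^sup>2) = q * (\<Prod>i<k. q ^ (2 * i + 3))" using Suc by simp
  finally show ?case by (simp add: mult.assoc)
qed simp

lemma q_weight_eq: "q ^ m / (q_int q m)\<^sup>2 = (1 - q)\<^sup>2 * q_weight q m"
  by (simp add: q_int_def q_weight_def power_divide)

section \<open>The special parameters in base q^2\<close>

context
  fixes q :: complex
  assumes q0: "q \<noteq> 0" and q1: "norm q < 1"
begin

lemma lin_factor_special:
  "lin_factor (inverse q) (q\<^sup>2) (q\<^sup>2) ((q\<^sup>2) ^ i) = 1 - q ^ (2 * i + 3)"
proof -
  have "inverse q * q\<^sup>2 * q\<^sup>2 = q ^ 3" using q0 by (simp add: power2_eq_square power3_eq_cube)
  then show ?thesis by (simp add: lin_factor_def power_add power_mult[symmetric] mult.commute)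
qed

lemma quad_factor_special:
  "quad_factor (inverse q) (q * (2 + t)) (q\<^sup>2) ((q\<^sup>2) ^ i)
   = (1 - q ^ (4 * i + 2))\<^sup>2 * (1 - t * q_weight q (4 * i + 2))"
proof -
  define x where "x = (q\<^sup>2) ^ i"
  have "inverse q * q\<^sup>2 * (q * (2 + t)) = (2 + t) * q\<^sup>2"
    "(inverse q)\<^sup>2 * (q\<^sup>2) ^ 3 = q ^ 4"
    using q0 by (simp_all add: eval_nat_numeral field_simps)
  then have "quad_factor (inverse q) (q * (2 + t)) (q\<^sup>2) x = 1 - (2 + t) * q\<^sup>2 * x\<^sup>2 + q ^ 4 * x ^ 4"
    by (simp only: quad_factor_def)
  also have "\<dots> = 1 - (2 + t) * (q\<^sup>2 * x\<^sup>2) + (q\<^sup>2 * x\<^sup>2)\<^sup>2"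
    by (simp add: power_mult_distrib mult.assoc flip: power_mult)
  also have "x\<^sup>2 = q ^ (4 * i)"
    by (simp add: x_def power_mult[symmetric] mult.commute)
  also have "q\<^sup>2 * q ^ (4 * i) = q ^ (4 * i + 2)"
    unfolding power_add by (rule mult.commute)
  also have "1 - (2 + t) * q ^ (4 * i + 2) + (q ^ (4 * i + 2))\<^sup>2
      = (1 - q ^ (4 * i + 2))\<^sup>2 * (1 - t * q_weight q (4 * i + 2))"
    by (rule square_minus_eq[OF q1]) simp
  finally show ?thesis by (simp add: x_def)
qed

lemma quad_numerator_special:
  "1 - q * (2 + t) * (q\<^sup>2) ^ i + q\<^sup>2 * ((q\<^sup>2) ^ i)\<^sup>2
   = (1 - q ^ (2 * i + 1))\<^sup>2 * (1 - t * q_weight q (2 * i + 1))"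
  using square_minus_eq[OF q1, of "2 * i + 1" t]
  by (simp add: power_mult[symmetric] power_mult_distrib mult_ac)

text \<open>Only 1 - s x + q x^2 and \<open>quad_factor\<close> involve s, hence t; the last
  quotient collects this dependence and equals 1 at t = 0.\<close>

lemma quad_ratio_special:
  "quad_ratio (inverse q) (q * (2 + t)) (q\<^sup>2) (q\<^sup>2) ((q\<^sup>2) ^ i)
   = q ^ (2 * i + 1) * (1 - inverse q * (q\<^sup>2) ^ i) * (1 - q ^ (2 * i + 1))\<^sup>2 * (q\<^sup>2 - q ^ (4 * i))
     / ((1 - q ^ (2 * i + 3)) * (1 - q ^ (4 * i + 4)) * (1 - q ^ (4 * i + 2))\<^sup>2)
     * ((1 - t * q_weight q (2 * i + 1)) / (1 - t * q_weight q (4 * i + 2)))"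
proof -
  have "inverse q * q\<^sup>2 * (q\<^sup>2) ^ i = q ^ (2 * i + 1)"
    using q0 by (simp add: power2_eq_square power_mult)
  moreover have "((q\<^sup>2) ^ i)\<^sup>2 = q ^ (4 * i)" by (simp add: power_mult[symmetric] mult.commute)
  moreover have "(q\<^sup>2)\<^sup>2 * q ^ (4 * i) = q ^ (4 * i + 4)"
    by (simp add: power_add power_mult[symmetric] mult.commute)
  ultimately show ?thesis
    unfolding quad_ratio_def lin_factor_special quad_factor_special quad_numerator_special
    by (simp add: mult_ac)
qed

lemma special_term_eq:
  "special_term q t k = special_term q 0 k
     * (\<Prod>i<k. (1 - t * q_weight q (2 * i + 1)) / (1 - t * q_weight q (4 * i + 2)))"
  unfolding quad_term_def quad_ratio_special[of t] quad_ratio_special[of 0] prod.distrib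
  by simp

text \<open>\<open>1 - a\<close> and \<open>lin_factor a e q 1\<close> become neighbours in the
  sequence 1 - q^(4j-1), so the first quotient telescopes over j. The second builds q-shifted
  factorials in base q^4, and the third carries t.\<close>

lemma quad_shift_special:
  "quad_shift (inverse q * (q\<^sup>2) ^ (2 * j)) (q * (2 + t)) (q\<^sup>2) (q\<^sup>2)
   = (1 - inverse q * q ^ (4 * j)) / (1 - inverse q * q ^ (4 * Suc j))
     * ((1 - q * (q ^ 4) ^ j) * (1 - q ^ 4 * (q ^ 4) ^ j)\<^sup>2 / ((1 - q ^ 5 * (q ^ 4) ^ j) * (1 - q\<^sup>2 * (q ^ 4) ^ j)\<^sup>2))
     * ((1 - t * q_weight q (4 * j + 4)) / (1 - t * q_weight q (4 * j + 2)))"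
proof -
  define y where "y = (q ^ 4) ^ j"
  have y: "(q\<^sup>2) ^ (2 * j) = y" "q ^ (4 * j) = y" "((q\<^sup>2) ^ j)\<^sup>2 = y"
    by (simp_all add: y_def power_mult[symmetric] mult.commute)
  have l1: "lin_factor (inverse q * y) (q\<^sup>2) (q\<^sup>2) 1 = 1 - inverse q * q ^ (4 * Suc j)"
    by (simp add: lin_factor_def power_add y(2)[symmetric] power2_eq_square eval_nat_numeral mult_ac)
  have l2: "lin_factor (inverse q * y) (q\<^sup>2) (q\<^sup>2) (q\<^sup>2) = 1 - q ^ 5 * y"
    using q0 by (simp add: lin_factor_def power2_eq_square eval_nat_numeral mult_ac)
  have d1: "quad_factor (inverse q * y) (q * (2 + t)) (q\<^sup>2) 1
      = (1 - q\<^sup>2 * y)\<^sup>2 * (1 - t * q_weight q (4 * j + 2))"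
  proof -
    have "quad_factor (inverse q * y) (q * (2 + t)) (q\<^sup>2) 1
        = quad_factor (inverse q) (q * (2 + t)) (q\<^sup>2) ((q\<^sup>2) ^ j)"
      using quad_factor_shift[of "inverse q" "q\<^sup>2" j "q * (2 + t)" 1] by (simp add: y(1))
    also have "\<dots> = (1 - q ^ (4 * j + 2))\<^sup>2 * (1 - t * q_weight q (4 * j + 2))"
      by (rule quad_factor_special)
    also have "q ^ (4 * j + 2) = q\<^sup>2 * y" unfolding power_add y(2) by (rule mult.commute)
    finally show ?thesis .
  qed
  have d2: "quad_factor (inverse q * y * q\<^sup>2) (q * (2 + t)) (q\<^sup>2) 1
      = (1 - q ^ 4 * y)\<^sup>2 * (1 - t * q_weight q (4 * j + 4))"
  proof -
    have p: "q ^ (4 * j + 4) = q ^ 4 * y" unfolding power_add y(2) by (rule mult.commute)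
    have "quad_factor (inverse q * y * q\<^sup>2) (q * (2 + t)) (q\<^sup>2) 1
        = 1 - (2 + t) * (q ^ 4 * y) + (q ^ 4 * y)\<^sup>2"
      using q0 by (simp add: quad_factor_def eval_nat_numeral mult_ac)
    also have "\<dots> = 1 - (2 + t) * q ^ (4 * j + 4) + (q ^ (4 * j + 4))\<^sup>2" by (simp only: p)
    also have "\<dots> = (1 - q ^ (4 * j + 4))\<^sup>2 * (1 - t * q_weight q (4 * j + 4))"
      by (rule square_minus_eq[OF q1]) simp
    also note p
    finally show ?thesis .
  qed
  have "inverse q * y * q\<^sup>2 = q * y" using q0 by (simp add: power2_eq_square)
  then show ?thesis
    unfolding quad_shift_def y l1 l2 d1 d2 y_def[symmetric]
    by (simp add: mult_ac)
qed

lemma prod_quad_shift_special: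
  "(\<Prod>j<n. quad_shift (inverse q * (q\<^sup>2) ^ (2 * j)) (q * (2 + t)) (q\<^sup>2) (q\<^sup>2))
   = (1 - inverse q) / (1 - inverse q * q ^ (4 * n))
     * (q_poch q (q ^ 4) n * (q_poch (q ^ 4) (q ^ 4) n)\<^sup>2 / (q_poch (q ^ 5) (q ^ 4) n * (q_poch (q\<^sup>2) (q ^ 4) n)\<^sup>2))
     * (\<Prod>j<n. (1 - t * q_weight q (4 * j + 4)) / (1 - t * q_weight q (4 * j + 2)))"
proof -
  \<comment> \<open>At n = 0 the power is 1/q, not a nonnegative power of q, hence the separate
    case.\<close>
  have nz: "1 - inverse q * q ^ (4 * n) \<noteq> 0" for n
  proof (cases n)
    case 0
    then show ?thesis using q1 by auto
  next
    case (Suc m)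
    then have "inverse q * q ^ (4 * n) = q ^ (4 * m + 3)"
      using q0 by (simp add: power_add eval_nat_numeral)
    then show ?thesis using one_minus_power_nonzero[OF q1, of "4 * m + 3"] by simp
  qed
  have "(\<Prod>j<n. (1 - inverse q * q ^ (4 * j)) / (1 - inverse q * q ^ (4 * Suc j)))
      = (1 - inverse q) / (1 - inverse q * q ^ (4 * n))"
    using nz nz[of 0] by (induction n) (simp_all del: mult_Suc_right)
  then show ?thesis
    unfolding quad_shift_special prod.distrib prod_dividef q_poch_def prod_power_distrib by simp
qed

lemma norm_square_less_one: "norm (q\<^sup>2) < 1"
  using q1 by (simp add: norm_power power_less_one_iff)

section \<open>Uniformity in t and differentiation at t = 0\<close>

lemma special_term_dominated:
  obtains h where "summable h"
    "\<And>t k. norm t \<le> (1 - norm q)\<^sup>2 / 2 \<Longrightarrow> norm (special_term q t k) \<le> h k"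
proof -
  \<comment> \<open>The radius of the disc doubles as lower bound for the denominators:
    \<open>quad_factor\<close> has a square of modulus at least (1 - |q|)^2 and a t-factor of
    modulus at least 1/2.\<close>
  define \<delta> where "\<delta> = (1 - norm q)\<^sup>2 / 2"
  have sq: "(1 - norm q)\<^sup>2 \<le> 1 - norm q"
    using q1 power_decreasing[of 1 2 "1 - norm q"] by simp
  have sq': "norm q ^ 2 \<le> norm q"
    using q1 power_decreasing[of 1 2 "norm q"] by simp
  have \<delta>: "0 < \<delta>" "\<delta> \<le> 1 - norm q" "\<delta> \<le> 1 / 2"
  proof -
    have "(1 - norm q)\<^sup>2 \<le> 1" using sq norm_ge_zero[of q] by linarith
    then show "0 < \<delta>" "\<delta> \<le> 1 - norm q" "\<delta> \<le> 1 / 2" using q1 sq by (auto simp: \<delta>_def)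
  qed
  have \<delta>': "\<delta> \<le> 1 - norm (q\<^sup>2)" using \<delta>(2) sq' by (simp add: norm_power)
  \<comment> \<open>The constants 3 and 1 bound |q (2 + t)| and |q^2|.\<close>
  define M where "M = quad_bound (norm (inverse q)) 3 1 \<delta>"
  have M: "M \<ge> 0" unfolding M_def by (rule quad_bound_nonneg) (use \<delta> in auto)
  show ?thesis
  proof
    show "summable (\<lambda>k. (1 + norm (inverse q)) * (\<Prod>i<k. M * norm (q\<^sup>2) ^ Suc i))"
      using M norm_square_less_one by (intro summable_mult summable_prod_geometric) auto
    fix t :: complex and k :: nat
    assume t: "norm t \<le> (1 - norm q)\<^sup>2 / 2"
    have "norm (2 + t) \<le> 3"
      using norm_triangle_ineq[of 2 t] t \<delta>(3) by (simp add: \<delta>_def)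
    then have s: "norm (q * (2 + t)) \<le> 3"
      unfolding norm_mult using q1 mult_mono[of "norm q" 1 "norm (2 + t)" 3] by simp
    have lin: "\<delta> \<le> norm (lin_factor (inverse q) (q\<^sup>2) (q\<^sup>2) ((q\<^sup>2) ^ i))" for i
      unfolding lin_factor_special
      using one_minus_norm_le_norm_one_minus_power[OF q1, of "2 * i + 3"] \<delta>(2) by linarith
    have quad: "\<delta> \<le> norm (quad_factor (inverse q) (q * (2 + t)) (q\<^sup>2) ((q\<^sup>2) ^ i))" for i
    proof -
      have "(1 - norm q)\<^sup>2 * (1 / 2)
          \<le> norm (1 - q ^ (4 * i + 2)) ^ 2 * norm (1 - t * q_weight q (4 * i + 2))"
        using one_minus_norm_le_norm_one_minus_power[OF q1, of "4 * i + 2"] q1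
          norm_one_minus_q_weight_ge[OF q1 _ t, of "4 * i + 2"]
        by (intro mult_mono power_mono) auto
      then show ?thesis
        unfolding quad_factor_special norm_mult norm_power by (simp add: \<delta>_def)
    qed
    show "norm (special_term q t k) \<le> (1 + norm (inverse q)) * (\<Prod>i<k. M * norm (q\<^sup>2) ^ Suc i)"
      unfolding M_def
      by (rule norm_quad_term_le[OF norm_square_less_one order_refl s _ \<delta>(1) \<delta>' lin quad])
         (use norm_square_less_one in auto)
  qed
qed

lemma special_term_LIMSEQ:
  assumes t: "norm t \<le> (1 - norm q)\<^sup>2 / 2"
  shows "(\<lambda>n. \<Prod>j<n. quad_shift (inverse q * (q\<^sup>2) ^ (2 * j)) (q * (2 + t)) (q\<^sup>2) (q\<^sup>2))
    \<longlonglongrightarrow> (\<Sum>k. special_term q t k)"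
proof (rule quad_summation[OF norm_square_less_one])
  fix i
  show "lin_factor (inverse q) (q\<^sup>2) (q\<^sup>2) ((q\<^sup>2) ^ i) \<noteq> 0"
    unfolding lin_factor_special by (rule one_minus_power_nonzero[OF q1]) simp
  have "1 - t * q_weight q (4 * i + 2) \<noteq> 0"
    using norm_one_minus_q_weight_ge[OF q1 _ t, of "4 * i + 2"] by auto
  then show "quad_factor (inverse q) (q * (2 + t)) (q\<^sup>2) ((q\<^sup>2) ^ i) \<noteq> 0"
    unfolding quad_factor_special
    using one_minus_power_nonzero[OF q1, of "4 * i + 2"] by simp
qed

lemma uniformly_convergent_weight_prod:
  "uniformly_convergent_on (cball 0 ((1 - norm q)\<^sup>2 / 2))
     (\<lambda>n t. \<Prod>i<n. (1 - t * q_weight q (4 * i + 4)) / (1 - t * q_weight q (4 * i + 2)))"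
proof -
  define r where "r = (1 - norm q)\<^sup>2 / 2"
  define a b where "a = (\<lambda>i. q_weight q (4 * i + 4))" and "b = (\<lambda>i. q_weight q (4 * i + 2))"
  \<comment> \<open>Each quotient is 1 + f i t, and f is dominated by the summable weights, so
    Weierstrass's test applies.\<close>
  define f where "f = (\<lambda>i t. t * (b i - a i) / (1 - t * b i))"
  have ge: "1 / 2 \<le> norm (1 - t * b i)" if "t \<in> cball 0 r" for t i
    using norm_one_minus_q_weight_ge[OF q1, of "4 * i + 2" t] that by (simp add: r_def b_def)
  have nz: "1 - t * b i \<noteq> 0" if "t \<in> cball 0 r" for t i
    using ge[OF that, of i] by auto
  have "uniformly_convergent_on (cball 0 r) (\<lambda>n t. \<Prod>i<n. 1 + f i t)"
  proof (rule uniformly_convergent_on_prod)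
    show "continuous_on (cball 0 r) (f n)" for n
      unfolding f_def using nz by (intro continuous_intros) auto
    have sm: "summable (\<lambda>i. 2 * r * (norm (b i) + norm (a i)))"
      unfolding a_def b_def
      by (intro summable_mult summable_add summable_norm_q_weight q1) auto
    have le: "norm (norm (f i t)) \<le> 2 * r * (norm (b i) + norm (a i))" if "t \<in> cball 0 r" for i t
    proof -
      have "norm (f i t) = norm t * norm (b i - a i) / norm (1 - t * b i)"
        by (simp add: f_def norm_mult norm_divide)
      also have "\<dots> \<le> r * (norm (b i) + norm (a i)) / (1 / 2)"
        using that ge[OF that, of i] by (intro frac_le mult_mono norm_triangle_ineq4) (auto simp: r_def)
      finally show ?thesis by simp
    qed
    have "uniform_limit (cball 0 r) (\<lambda>N t. \<Sum>n<N. norm (f n t)) (\<lambda>t. \<Sum>n. norm (f n t)) sequentially"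
      by (rule Weierstrass_m_test[OF le sm])
    then show "uniformly_convergent_on (cball 0 r) (\<lambda>N t. \<Sum>n<N. norm (f n t))"
      by (auto simp: uniformly_convergent_on_def)
  qed simp
  also have "?this \<longleftrightarrow> uniformly_convergent_on (cball 0 r) (\<lambda>n t. \<Prod>i<n. (1 - t * a i) / (1 - t * b i))"
  proof (rule uniformly_convergent_cong)
    show "\<forall>\<^sub>F n in sequentially. \<forall>t\<in>cball 0 r. (\<Prod>i<n. 1 + f i t) = (\<Prod>i<n. (1 - t * a i) / (1 - t * b i))"
    proof (intro always_eventually allI ballI prod.cong refl)
      fix t :: complex and i assume "t \<in> cball 0 r"
      then show "1 + f i t = (1 - t * a i) / (1 - t * b i)"
        using nz[of t i] by (simp add: f_def field_simps)
    qed
  qed simp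
  finally show ?thesis by (simp add: r_def a_def b_def)
qed

text \<open>The infinite-product prefactor of the final identity, with repeated parameters written
  as squares.\<close>

definition limit_const where
  "limit_const = (q_poch_inf q (q ^ 4) * (q_poch_inf (q ^ 4) (q ^ 4))\<^sup>2
    / (q_poch_inf (q ^ 5) (q ^ 4) * (q_poch_inf (q\<^sup>2) (q ^ 4))\<^sup>2))"

lemma q_poch_quotient_LIMSEQ:
  "(\<lambda>n. (1 - inverse q) / (1 - inverse q * q ^ (4 * n))
     * (q_poch q (q ^ 4) n * (q_poch (q ^ 4) (q ^ 4) n)\<^sup>2 / (q_poch (q ^ 5) (q ^ 4) n * (q_poch (q\<^sup>2) (q ^ 4) n)\<^sup>2)))
   \<longlonglongrightarrow> (1 - inverse q) * limit_const"
proof -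
  have q4: "norm (q ^ 4) < 1" using q1 by (simp add: norm_power power_less_one_iff)
  have nz: "q_poch_inf (q ^ b) (q ^ 4) \<noteq> 0" if "b > 0" for b
  proof (rule q_poch_inf_nonzero[OF q4])
    show "1 - q ^ b * (q ^ 4) ^ i \<noteq> 0" for i
      unfolding power_mult[symmetric] power_add[symmetric]
      using that by (intro one_minus_power_nonzero[OF q1]) simp
  qed
  have "(\<lambda>n. (q ^ 4) ^ n) \<longlonglongrightarrow> 0" using q4 by (rule LIMSEQ_power_zero)
  then have z: "(\<lambda>n. q ^ (4 * n)) \<longlonglongrightarrow> 0" by (simp add: power_mult)
  have "(\<lambda>n. (1 - inverse q) / (1 - inverse q * q ^ (4 * n))
     * (q_poch q (q ^ 4) n * (q_poch (q ^ 4) (q ^ 4) n)\<^sup>2 / (q_poch (q ^ 5) (q ^ 4) n * (q_poch (q\<^sup>2) (q ^ 4) n)\<^sup>2)))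
   \<longlonglongrightarrow> (1 - inverse q) / (1 - inverse q * 0) * limit_const"
    unfolding limit_const_def using nz[of 5] nz[of 2]
    by (intro tendsto_intros q_poch_LIMSEQ q4 z) auto
  then show ?thesis by simp
qed

text \<open>Both sides of the specialized summation are differentiable in t near 0, one as a
  dominated series of holomorphic terms, the other as a uniform limit of holomorphic products; the
  claims compare their derivatives at 0.\<close>

lemma special_term_derivative_sums:
  "(\<lambda>i. q_weight q (4 * i + 2) - q_weight q (4 * i + 4)) sums
     (\<Sum>i. q_weight q (4 * i + 2) - q_weight q (4 * i + 4))" (is ?A)
  "(\<lambda>k. special_term q 0 k * (\<Sum>i<k. q_weight q (4 * i + 2) - q_weight q (2 * i + 1))) sums
     ((1 - inverse q) * limit_const * (\<Sum>i. q_weight q (4 * i + 2) - q_weight q (4 * i + 4)))" (is ?B)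
proof -
  define r where "r = (1 - norm q)\<^sup>2 / 2"
  have r: "r > 0" using q1 by (simp add: r_def)
  define P where "P = (\<lambda>n t. \<Prod>i<n. (1 - t * q_weight q (4 * i + 4)) / (1 - t * q_weight q (4 * i + 2)))"
  have nz: "1 - t * q_weight q m \<noteq> 0" if "t \<in> cball 0 r" "m > 0" for t m
    using norm_one_minus_q_weight_ge[OF q1 that(2), of t] that(1) by (auto simp: r_def)
  obtain h where h: "summable h" "\<And>t k. norm t \<le> r \<Longrightarrow> norm (special_term q t k) \<le> h k"
    using special_term_dominated unfolding r_def by blast
  have T_eq: "(\<lambda>t. special_term q t k) = (\<lambda>t. special_term q 0 k
      * (\<Prod>i<k. (1 - t * q_weight q (2 * i + 1)) / (1 - t * q_weight q (4 * i + 2))))" for k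
    by (rule ext, rule special_term_eq)
  have T_holo: "(\<lambda>t. special_term q t k) holomorphic_on ball 0 r" for k
    by (subst T_eq, intro holomorphic_intros) (use nz in auto)
  have P_holo: "P n holomorphic_on ball 0 r" and P_cont: "continuous_on (cball 0 r) (P n)" for n
    unfolding P_def using nz by (intro holomorphic_intros continuous_intros; auto)+
  have T_deriv: "((\<lambda>t. special_term q t k) has_field_derivative deriv (\<lambda>t. special_term q t k) t) (at t)"
    if "t \<in> ball 0 r" for k t
    using T_holo that by (intro holomorphic_derivI) auto
  have T_bound: "\<forall>\<^sub>F k in sequentially. \<forall>t\<in>ball 0 r. norm (special_term q t k) \<le> h k"
    using h(2) by (intro always_eventually) auto
  \<comment> \<open>For holomorphic terms a majorant of the terms alone permits termwise
    differentiation.\<close>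
  from series_and_derivative_comparison[OF open_ball h(1) T_deriv T_bound]
  obtain g g' where "\<forall>t\<in>ball 0 r. (\<lambda>k. special_term q t k) sums g t
      \<and> (\<lambda>k. deriv (\<lambda>t. special_term q t k) t) sums g' t \<and> (g has_field_derivative g' t) (at t)"
    by blast
  then have g: "\<And>t. t \<in> ball 0 r \<Longrightarrow> (\<lambda>k. special_term q t k) sums g t"
      "\<And>t. t \<in> ball 0 r \<Longrightarrow> (\<lambda>k. deriv (\<lambda>t. special_term q t k) t) sums g' t"
      "\<And>t. t \<in> ball 0 r \<Longrightarrow> (g has_field_derivative g' t) (at t)"
    by blast+
  obtain U where U: "uniform_limit (cball 0 r) P U sequentially"
    using uniformly_convergent_weight_prod unfolding uniformly_convergent_on_def r_def P_def by blast
  have "\<forall>\<^sub>F n in sequentially. continuous_on (cball 0 r) (P n) \<and>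
      (\<forall>w\<in>ball 0 r. (P n has_field_derivative deriv (P n) w) (at w))"
    using P_holo P_cont by (intro always_eventually) (auto intro: holomorphic_derivI)
  from has_complex_derivative_uniform_limit[OF this U _ r]
  obtain U' where U': "\<And>w. w \<in> ball 0 r \<Longrightarrow> (U has_field_derivative U' w) (at w) \<and> (\<lambda>n. deriv (P n) w) \<longlonglongrightarrow> U' w"
    by auto
  \<comment> \<open>These derivatives are partial sums, so their convergence is already the
    summability of the right-hand series.\<close>
  have "deriv (P n) 0 = (\<Sum>i<n. q_weight q (4 * i + 2) - q_weight q (4 * i + 4))" for n
    unfolding P_def by (rule DERIV_imp_deriv[OF has_field_derivative_prod_ratio_0])
  then have U'_sums: "(\<lambda>i. q_weight q (4 * i + 2) - q_weight q (4 * i + 4)) sums U' 0"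
    using U'[of 0] r by (simp add: sums_def)
  then show ?A by (simp add: sums_iff)
  \<comment> \<open>Both sides are limits of the same products of shift factors.\<close>
  have gU: "g t = (1 - inverse q) * limit_const * U t" if t: "t \<in> ball 0 r" for t
  proof (rule LIMSEQ_unique)
    show "(\<lambda>n. \<Prod>j<n. quad_shift (inverse q * (q\<^sup>2) ^ (2 * j)) (q * (2 + t)) (q\<^sup>2) (q\<^sup>2)) \<longlonglongrightarrow> g t"
      using special_term_LIMSEQ[of t] g(1)[OF t] t by (simp add: r_def sums_iff)
    have "(\<lambda>n. P n t) \<longlonglongrightarrow> U t" using tendsto_uniform_limitI[OF U] t by auto
    from tendsto_mult[OF q_poch_quotient_LIMSEQ this]
    show "(\<lambda>n. \<Prod>j<n. quad_shift (inverse q * (q\<^sup>2) ^ (2 * j)) (q * (2 + t)) (q\<^sup>2) (q\<^sup>2))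
        \<longlonglongrightarrow> (1 - inverse q) * limit_const * U t"
      unfolding prod_quad_shift_special P_def .
  qed
  have "((\<lambda>t. (1 - inverse q) * limit_const * U t) has_field_derivative (1 - inverse q) * limit_const * U' 0) (at 0)"
    using U'[of 0] r by (intro DERIV_cmult) auto
  then have "(g has_field_derivative (1 - inverse q) * limit_const * U' 0) (at 0)"
    by (rule has_field_derivative_transform_within_open[of _ _ _ "ball 0 r"]) (use gU r in auto)
  then have g'0: "g' 0 = (1 - inverse q) * limit_const * U' 0"
    using g(3)[of 0] r by (auto intro: DERIV_unique)
  have "deriv (\<lambda>t. special_term q t k) 0 = special_term q 0 k * (\<Sum>i<k. q_weight q (4 * i + 2) - q_weight q (2 * i + 1))" for k
    by (subst T_eq, intro DERIV_imp_deriv DERIV_cmult has_field_derivative_prod_ratio_0)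
  then show ?B using g(2)[of 0] r U'_sums by (simp add: g'0 sums_iff)
qed

section \<open>Return to q-shifted factorials\<close>

text \<open>Writing q^2 - q^(4i) as q^2 (1 - q^(-2) q^(4i)) raises the power q^(2i+1) in the ratio
  to q^(2i+3). As 1 + 3 + ... + (2k+1) = (k+1)^2, these powers and the extra q give the quadratic
  exponent.\<close>

lemma q_poch_term_eq:
  "(q_pochs [q powi (-1), q, q] (q\<^sup>2) k * q_poch (q powi (-2)) (q ^ 4) k)
     / (q_pochs [q ^ 4, q\<^sup>2, q\<^sup>2] (q ^ 4) k * q_poch (q ^ 3) (q\<^sup>2) k) * q ^ ((k + 1)\<^sup>2)
   = q * (\<Prod>i<k. quad_ratio (inverse q) (q * 2) (q\<^sup>2) (q\<^sup>2) ((q\<^sup>2) ^ i))"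
proof -
  have "quad_ratio (inverse q) (q * 2) (q\<^sup>2) (q\<^sup>2) ((q\<^sup>2) ^ i)
      = q ^ (2 * i + 3) * ((1 - inverse q * (q\<^sup>2) ^ i) * (1 - q * (q\<^sup>2) ^ i)\<^sup>2 * (1 - inverse (q\<^sup>2) * (q ^ 4) ^ i)
        / ((1 - q ^ 3 * (q\<^sup>2) ^ i) * (1 - q ^ 4 * (q ^ 4) ^ i) * (1 - q\<^sup>2 * (q ^ 4) ^ i)\<^sup>2))" for i
  proof -
    have "1 - q ^ (2 * i + 1) = 1 - q * (q\<^sup>2) ^ i" "1 - q ^ (2 * i + 3) = 1 - q ^ 3 * (q\<^sup>2) ^ i"
      "1 - q ^ (4 * i + 4) = 1 - q ^ 4 * (q ^ 4) ^ i" "1 - q ^ (4 * i + 2) = 1 - q\<^sup>2 * (q ^ 4) ^ i"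
      unfolding power_add power_mult power_one_right by (simp_all add: mult.commute)
    moreover have "q\<^sup>2 - q ^ (4 * i) = q\<^sup>2 * (1 - inverse (q\<^sup>2) * (q ^ 4) ^ i)"
      using q0 by (simp add: power_mult[symmetric] right_diff_distrib)
    moreover have "q ^ (2 * i + 3) = q ^ (2 * i + 1) * q\<^sup>2"
      unfolding power_add[symmetric] by (rule arg_cong[where f = "\<lambda>n. q ^ n"]) simp
    ultimately show ?thesis
      using quad_ratio_special[of 0 i]
      by (simp only: add_0_right mult_zero_left diff_zero div_by_1 mult_1_left mult_1_right times_divide_eq_right
          times_divide_eq_left mult_ac)
  qed
  then have "q * (\<Prod>i<k. quad_ratio (inverse q) (q * 2) (q\<^sup>2) (q\<^sup>2) ((q\<^sup>2) ^ i))
      = q * (\<Prod>i<k. q ^ (2 * i + 3)) * (\<Prod>i<k. (1 - inverse q * (q\<^sup>2) ^ i) * (1 - q * (q\<^sup>2) ^ i)\<^sup>2 * (1 - inverse (q\<^sup>2) * (q ^ 4) ^ i)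
        / ((1 - q ^ 3 * (q\<^sup>2) ^ i) * (1 - q ^ 4 * (q ^ 4) ^ i) * (1 - q\<^sup>2 * (q ^ 4) ^ i)\<^sup>2))"
    by (simp only: prod.distrib mult.assoc)
  then show ?thesis
    unfolding prod_odd_powers
    by (simp add: q_pochs_def q_poch_def prod.distrib prod_dividef power_int_minus prod_power_distrib power2_eq_square mult_ac)
qed

end

theorem theorem2p2:
  fixes q :: complex
  assumes "0 < norm q" and "norm q < 1"
  shows "summable (\<lambda>m. let i = Suc m in
             q ^ (4 * i - 2) / (q_int q (4 * i - 2))\<^sup>2 - q ^ (4 * i) / (q_int q (4 * i))\<^sup>2) \<and>
         (\<lambda>m. let k = Suc m in
            q_int q (6 * k - 1)
            * ((q_pochs [q powi (-1), q, q] (q ^ 2) k * q_poch (q powi (-2)) (q ^ 4) k)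
               / (q_pochs [q ^ 4, q ^ 2, q ^ 2] (q ^ 4) k * q_poch (q ^ 3) (q ^ 2) k))
            * q ^ ((k + 1) ^ 2)
            * (\<Sum>i = 1..k. q ^ (2 * i - 1) / (q_int q (2 * i - 1))\<^sup>2
                          - q ^ (4 * i - 2) / (q_int q (4 * i - 2))\<^sup>2))
         sums
         (q_pochs_inf [q, q ^ 4, q ^ 4] (q ^ 4) / q_pochs_inf [q ^ 5, q ^ 2, q ^ 2] (q ^ 4)
          * (\<Sum>m. let i = Suc m in
               q ^ (4 * i - 2) / (q_int q (4 * i - 2))\<^sup>2 - q ^ (4 * i) / (q_int q (4 * i))\<^sup>2))"
proof -
  have q0: "q \<noteq> 0" and q1: "norm q < 1" using assms by auto
  have q_ne: "1 - q \<noteq> 0" using one_minus_power_nonzero[OF q1, of 1] by simp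
  define R where "R = (\<Sum>i. q_weight q (4 * i + 2) - q_weight q (4 * i + 4))"
  define d where "d = (\<lambda>k. special_term q 0 k * (\<Sum>i<k. q_weight q (4 * i + 2) - q_weight q (2 * i + 1)))"
  have w: "(let i = Suc m in q ^ (4 * i - 2) / (q_int q (4 * i - 2))\<^sup>2 - q ^ (4 * i) / (q_int q (4 * i))\<^sup>2)
      = (1 - q)\<^sup>2 * (q_weight q (4 * m + 2) - q_weight q (4 * m + 4))" for m
  proof -
    have "4 * Suc m - 2 = 4 * m + 2" "4 * Suc m = 4 * m + 4" by simp_all
    then show ?thesis unfolding Let_def q_weight_eq by (simp only: right_diff_distrib)
  qed
  have R: "(\<lambda>m. (1 - q)\<^sup>2 * (q_weight q (4 * m + 2) - q_weight q (4 * m + 4))) sums ((1 - q)\<^sup>2 * R)"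
    unfolding R_def by (intro sums_mult special_term_derivative_sums(1)[OF q0 q1])
  \<comment> \<open>The factor collects q from \<open>q_poch_term_eq\<close>, 1/(1 - q) from
    \<open>q_int\<close> and (1 - q)^2 from the weights; the sign appears because d carries the
    inner differences in reverse order.\<close>
  have summand: "(let k = Suc m in
            q_int q (6 * k - 1)
            * ((q_pochs [q powi (-1), q, q] (q ^ 2) k * q_poch (q powi (-2)) (q ^ 4) k)
               / (q_pochs [q ^ 4, q ^ 2, q ^ 2] (q ^ 4) k * q_poch (q ^ 3) (q ^ 2) k))
            * q ^ ((k + 1) ^ 2)
            * (\<Sum>i = 1..k. q ^ (2 * i - 1) / (q_int q (2 * i - 1))\<^sup>2
                          - q ^ (4 * i - 2) / (q_int q (4 * i - 2))\<^sup>2))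
      = - (q * (1 - q)) * d (Suc m)" for m
  proof -
    define k where "k = Suc m"
    define V where "V = (q_pochs [q powi (-1), q, q] (q ^ 2) k * q_poch (q powi (-2)) (q ^ 4) k)
               / (q_pochs [q ^ 4, q ^ 2, q ^ 2] (q ^ 4) k * q_poch (q ^ 3) (q ^ 2) k)"
    define Q where "Q = (\<Prod>i<k. quad_ratio (inverse q) (q * 2) (q\<^sup>2) (q\<^sup>2) ((q\<^sup>2) ^ i))"
    define H where "H = (\<Sum>i<k. q_weight q (4 * i + 2) - q_weight q (2 * i + 1))"
    have V: "V * q ^ ((k + 1)\<^sup>2) = q * Q"
      unfolding V_def Q_def by (rule q_poch_term_eq[OF q0 q1])
    have "(\<Sum>i = 1..k. q ^ (2 * i - 1) / (q_int q (2 * i - 1))\<^sup>2 - q ^ (4 * i - 2) / (q_int q (4 * i - 2))\<^sup>2)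
        = (\<Sum>i<k. (1 - q)\<^sup>2 * (q_weight q (2 * i + 1) - q_weight q (4 * i + 2)))"
      unfolding One_nat_def sum.atLeast1_atMost_eq
    proof (rule sum.cong[OF refl])
      fix i
      have "2 * Suc i - Suc 0 = 2 * i + 1" "4 * Suc i - 2 = 4 * i + 2" by simp_all
      then show "q ^ (2 * Suc i - Suc 0) / (q_int q (2 * Suc i - Suc 0))\<^sup>2 - q ^ (4 * Suc i - 2) / (q_int q (4 * Suc i - 2))\<^sup>2
          = (1 - q)\<^sup>2 * (q_weight q (2 * i + Suc 0) - q_weight q (4 * i + 2))"
        unfolding q_weight_eq by (simp add: right_diff_distrib)
    qed
    also have "\<dots> = - ((1 - q)\<^sup>2 * H)"
      unfolding H_def sum_distrib_left[symmetric] by (simp add: sum_subtractf right_diff_distrib)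
    finally have H: "(\<Sum>i = 1..k. q ^ (2 * i - 1) / (q_int q (2 * i - 1))\<^sup>2 - q ^ (4 * i - 2) / (q_int q (4 * i - 2))\<^sup>2)
        = - ((1 - q)\<^sup>2 * H)" .
    have "inverse q * (q\<^sup>2) ^ (3 * k) = q ^ (6 * k - 1)"
    proof -
      have "(q\<^sup>2) ^ (3 * k) = q * q ^ (6 * k - 1)"
        unfolding power_mult[symmetric] power_Suc[symmetric] by (rule arg_cong[where f = "\<lambda>n. q ^ n"]) (simp add: k_def)
      then show ?thesis using q0 by simp
    qed
    then have d: "d k = (1 - q ^ (6 * k - 1)) * Q * H"
      by (simp add: d_def quad_term_def Q_def H_def)
    have "q_int q (6 * k - 1) * V * q ^ ((k + 1)\<^sup>2) * - ((1 - q)\<^sup>2 * H)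
        = (1 - q ^ (6 * k - 1)) / (1 - q) * (q * Q) * - ((1 - q)\<^sup>2 * H)"
      unfolding V[symmetric] q_int_def by (simp add: mult_ac)
    also have "\<dots> = - (q * (1 - q)) * d k"
      unfolding d using q_ne by (simp add: power2_eq_square)
    finally show ?thesis
      unfolding Let_def k_def[symmetric] H V_def[symmetric] .
  qed
  have "d sums ((1 - inverse q) * limit_const q * R)"
    unfolding d_def R_def by (rule special_term_derivative_sums(2)[OF q0 q1])
  \<comment> \<open>The inner sum is empty at k = 0, so dropping that term changes nothing.\<close>
  then have "(\<lambda>m. d (Suc m)) sums ((1 - inverse q) * limit_const q * R)"
    by (subst sums_Suc_iff) (simp add: d_def)
  then have "(\<lambda>m. - (q * (1 - q)) * d (Suc m)) sums (- (q * (1 - q)) * ((1 - inverse q) * limit_const q * R))"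
    by (rule sums_mult)
  \<comment> \<open>Here -q (1 - q) (1 - 1/q) = (1 - q)^2, exactly the factor that turns weights
    back into q-integers.\<close>
  also have "- (q * (1 - q)) * ((1 - inverse q) * limit_const q * R) = limit_const q * ((1 - q)\<^sup>2 * R)"
    using q0 by (simp add: power2_eq_square field_simps)
  also have "limit_const q = q_pochs_inf [q, q ^ 4, q ^ 4] (q ^ 4) / q_pochs_inf [q ^ 5, q ^ 2, q ^ 2] (q ^ 4)"
    by (simp add: limit_const_def[OF q0 q1] q_pochs_inf_def power2_eq_square)
  finally show ?thesis
    unfolding w summand using R by (simp add: sums_iff)
qed

end
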